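(* Let $\varphi$ be an unsatisfiable CNF with $n$ variables and let $(T,\{B(t)\}_{t\in V(T)})$ be a one-sided tree decomposition of the incidence graph of $\varphi$ of width $k$, where $T$ is a rooted binary tree. Then there is a regular resolution refutation of $\varphi$ of size $O(4^k n)$.
   Context: A CNF is a set of clauses, each a set of literals. The incidence graph of $\varphi$ is the bipartite graph on variables and clauses of $\varphi$ with $x$ adjacent to $C$ iff $x$ occurs in $C$. A tree decomposition of it with rooted tree $T$ is one-sided if for every clause $C$, the set of nodes whose bags contain $C$ induces a directed path of $T$ (from an ancestor down to a descendant); its width is the maximum bag size minus one. A regular resolution refutation of unsatisfiable $\varphi$ is a DAG with a single source, every non-sink node having exactly two out-neighbours, each non-sink node labelled by a variable so that no variable labels two nodes on one directed path, the two out-edges of a node labelled $x$ labelled $x$ and $\neg x$; each sink $u$ is labelled by a clause $C$ of $\varphi$ such that for every source-to-$u$ path $P$, the set $A(P)$ of edge labels contains $\neg\ell$ for every literal $\ell\in C$. Size is the number of nodes. *)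

theory Defs
  imports Complex_Main "Graph_Theory.Graph_Theory"
begin

section \<open>CNF formulas\<close>

datatype 'v literal = Pos 'v | Neg 'v

fun atom :: "'v literal \<Rightarrow> 'v" where
  "atom (Pos x) = x"
| "atom (Neg x) = x"

fun negate :: "'v literal \<Rightarrow> 'v literal" where
  "negate (Pos x) = Neg x"
| "negate (Neg x) = Pos x"

type_synonym 'v clause = "'v literal set"
type_synonym 'v clauses = "'v clause set"

definition cnf :: "'v clauses \<Rightarrow> bool" where
  "cnf \<phi> \<longleftrightarrow> finite \<phi> \<and> (\<forall>C\<in>\<phi>. finite C)"

definition cnf_vars :: "'v clauses \<Rightarrow> 'v set" where
  "cnf_vars \<phi> = (\<Union>C\<in>\<phi>. atom ` C)"

fun lit_true :: "('v \<Rightarrow> bool) \<Rightarrow> 'v literal \<Rightarrow> bool" where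
  "lit_true \<alpha> (Pos x) \<longleftrightarrow> \<alpha> x"
| "lit_true \<alpha> (Neg x) \<longleftrightarrow> \<not> \<alpha> x"

definition satisfiable :: "'v clauses \<Rightarrow> bool" where
  "satisfiable \<phi> \<longleftrightarrow> (\<exists>\<alpha>. \<forall>C\<in>\<phi>. \<exists>l\<in>C. lit_true \<alpha> l)"

text \<open>An undirected graph is represented by a symmetric arc set.\<close>

definition incidence_graph :: "'v clauses \<Rightarrow> ('v + 'v clause) pair_pre_digraph" where
  "incidence_graph \<phi> =
    \<lparr> pverts = Inl ` cnf_vars \<phi> \<union> Inr ` \<phi>,
      parcs = {(Inl x, Inr C) |x C. C \<in> \<phi> \<and> x \<in> atom ` C}
            \<union> {(Inr C, Inl x) |x C. C \<in> \<phi> \<and> x \<in> atom ` C} \<rparr>"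


section \<open>Tree decompositions over rooted trees\<close>

text \<open>The arcs of a rooted tree point from parent to child. The predicate
  \<^const>\<open>tree\<close> is not used, because on digraphs it only excludes directed cycles.\<close>

definition rooted_tree :: "'t pair_pre_digraph \<Rightarrow> 't \<Rightarrow> bool" where
  "rooted_tree T r \<longleftrightarrow>
     pair_fin_digraph T \<and> r \<in> pverts T \<and> in_degree T r = 0 \<and>
     (\<forall>t \<in> pverts T - {r}. in_degree T t = 1) \<and>
     (\<forall>t \<in> pverts T. r \<rightarrow>\<^sup>*\<^bsub>with_proj T\<^esub> t)"

definition rooted_binary_tree :: "'t pair_pre_digraph \<Rightarrow> 't \<Rightarrow> bool" where
  "rooted_binary_tree T r \<longleftrightarrow> rooted_tree T r \<and> (\<forall>t \<in> pverts T. out_degree T t \<le> 2)"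

definition bag_nodes :: "'t pair_pre_digraph \<Rightarrow> ('t \<Rightarrow> 'a set) \<Rightarrow> 'a \<Rightarrow> 't set" where
  "bag_nodes T B v = {t \<in> pverts T. v \<in> B t}"

definition tree_decomposition ::
    "'a pair_pre_digraph \<Rightarrow> 't pair_pre_digraph \<Rightarrow> 't \<Rightarrow> ('t \<Rightarrow> 'a set) \<Rightarrow> bool" where
  "tree_decomposition G T r B \<longleftrightarrow>
     rooted_tree T r \<and>
     (\<forall>t \<in> pverts T. B t \<subseteq> pverts G) \<and>
     (\<forall>v \<in> pverts G. \<exists>t \<in> pverts T. v \<in> B t) \<and>
     (\<forall>(u, v) \<in> parcs G. \<exists>t \<in> pverts T. u \<in> B t \<and> v \<in> B t) \<and>
     (\<forall>v \<in> pverts G. connected (with_proj T \<restriction> bag_nodes T B v))"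

definition td_width :: "'t pair_pre_digraph \<Rightarrow> ('t \<Rightarrow> 'a set) \<Rightarrow> nat" where
  "td_width T B = Max ((\<lambda>t. card (B t)) ` pverts T) - 1"

definition induces_directed_path :: "'t pair_pre_digraph \<Rightarrow> 't set \<Rightarrow> bool" where
  "induces_directed_path T W \<longleftrightarrow>
     (let H = with_proj T \<restriction> W in
      \<exists>u p v. pre_digraph.apath H u p v \<and>
        set (pre_digraph.awalk_verts H u p) = verts H \<and> set p = arcs H)"

definition one_sided ::
    "'v clauses \<Rightarrow> 't pair_pre_digraph \<Rightarrow> ('t \<Rightarrow> ('v + 'v clause) set) \<Rightarrow> bool" where
  "one_sided \<phi> T B \<longleftrightarrow> (\<forall>C\<in>\<phi>. induces_directed_path T (bag_nodes T B (Inr C)))"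


section \<open>Regular resolution refutations\<close>

text \<open>The node labels are split into \<open>var\<close> (relevant on non-sinks) and \<open>cl\<close> (relevant on
  sinks). In the last condition, \<open>lab ` set p\<close> is the set of edge labels along the path \<open>p\<close>.\<close>

definition regular_resolution_refutation ::
    "'v clauses \<Rightarrow> 'n pair_pre_digraph \<Rightarrow> ('n \<Rightarrow> 'v) \<Rightarrow> ('n \<times> 'n \<Rightarrow> 'v literal)
      \<Rightarrow> ('n \<Rightarrow> 'v clause) \<Rightarrow> bool" where
  "regular_resolution_refutation \<phi> R var lab cl \<longleftrightarrow>
     pair_fin_digraph R \<and> acyclic (parcs R) \<and>
     (\<exists>!s. s \<in> pverts R \<and> in_degree R s = 0) \<and>
     (\<forall>u \<in> pverts R. out_degree R u \<noteq> 0 \<longrightarrow>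
        out_degree R u = 2 \<and> var u \<in> cnf_vars \<phi> \<and>
        lab ` out_arcs R u = {Pos (var u), Neg (var u)}) \<and>
     (\<forall>u p v. pre_digraph.apath R u p v \<longrightarrow>
        inj_on var {w \<in> set (pre_digraph.awalk_verts R u p). out_degree R w \<noteq> 0}) \<and>
     (\<forall>u \<in> pverts R. out_degree R u = 0 \<longrightarrow>
        cl u \<in> \<phi> \<and>
        (\<forall>s p. in_degree R s = 0 \<and> pre_digraph.apath R s p u \<longrightarrow>
           (\<forall>l \<in> cl u. negate l \<in> lab ` set p)))"

end

theory Submission
  imports Defs
begin

text \<open>Order the variables by \<open>y < x\<close> if the topmost bag of \<open>y\<close> lies above the topmost bag of
  \<open>x\<close>, breaking ties arbitrarily. This is a forest order, and one-sidedness makes the variables of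
  every clause a chain. Query the variables along a branch of the forest. When \<open>x\<close> is about to be
  queried, only the set of clauses that contain a variable \<open>\<ge> x\<close> and are not yet satisfied
  matters. If the topmost bag of \<open>x\<close> is \<open>B t\<close>, such a clause either lies in \<open>B t\<close> or has all its
  queried variables in \<open>B t\<close>, so there are at most \<open>2 ^ card (B t)\<close> such sets. After \<open>x\<close> is answered,
  the remaining clauses split into parts with disjoint variables, one for each child of \<open>x\<close> in the
  forest. As the whole is unsatisfiable, one part is, and the search continues there. This even
  gives size \<open>O(2 ^ k * n)\<close>.\<close>

section \<open>Literals and the answers to queries\<close>

definition answer :: "'v \<Rightarrow> bool \<Rightarrow> 'v literal" where
  "answer x b = (if b then Pos x else Neg x)"

lemma negate_eq_answer: "atom l = x \<Longrightarrow> l \<noteq> answer x b \<Longrightarrow> negate l = answer x b"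
  by (cases l) (auto simp: answer_def split: if_splits)

lemma lit_true_answer: "\<alpha> x = b \<Longrightarrow> lit_true \<alpha> (answer x b)"
  by (auto simp: answer_def)

lemma lit_true_cong: "\<alpha> (atom l) = \<beta> (atom l) \<Longrightarrow> lit_true \<alpha> l = lit_true \<beta> l"
  by (cases l) auto

lemma lit_true_fun_upd_same: "atom l = x \<Longrightarrow> lit_true (\<alpha>(x := b)) l \<longleftrightarrow> l = answer x b"
  by (cases l) (auto simp: answer_def)

lemma atom_in_vars: "C \<in> \<phi> \<Longrightarrow> x \<in> atom ` C \<Longrightarrow> x \<in> cnf_vars \<phi>"
  by (auto simp: cnf_vars_def)

section \<open>Decision DAGs\<close>

text \<open>\<open>Avail u\<close> contains all variables queried from \<open>u\<close> on, and every literal in \<open>Must u\<close> labels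
  an edge of every path from the source to \<open>u\<close>.\<close>

locale decision_dag =
  fixes \<phi> :: "'v clauses" and N :: "'n set" and s\<^sub>0 :: 'n and ch :: "'n \<Rightarrow> bool \<Rightarrow> 'n"
    and snk :: "'n \<Rightarrow> bool" and var :: "'n \<Rightarrow> 'v" and cl :: "'n \<Rightarrow> 'v clause"
    and Avail :: "'n \<Rightarrow> 'v set" and Must :: "'n \<Rightarrow> 'v literal set"
  assumes finite_N: "finite N" and source_in: "s\<^sub>0 \<in> N"
    and ch_in: "u \<in> N \<Longrightarrow> \<not> snk u \<Longrightarrow> ch u b \<in> N"
    and ch_not_source: "u \<in> N \<Longrightarrow> \<not> snk u \<Longrightarrow> ch u b \<noteq> s\<^sub>0"
    and ch_distinct: "u \<in> N \<Longrightarrow> \<not> snk u \<Longrightarrow> ch u True \<noteq> ch u False"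
    and var_in: "u \<in> N \<Longrightarrow> \<not> snk u \<Longrightarrow> var u \<in> cnf_vars \<phi>"
    and var_Avail: "u \<in> N \<Longrightarrow> \<not> snk u \<Longrightarrow> var u \<in> Avail u"
    and Avail_ch: "u \<in> N \<Longrightarrow> \<not> snk u \<Longrightarrow> Avail (ch u b) \<subseteq> Avail u - {var u}"
    and Must_source: "Must s\<^sub>0 = {}"
    and Must_ch: "u \<in> N \<Longrightarrow> \<not> snk u \<Longrightarrow> Must (ch u b) \<subseteq> insert (answer (var u) b) (Must u)"
    and cl_in: "u \<in> N \<Longrightarrow> snk u \<Longrightarrow> cl u \<in> \<phi>"
    and cl_Must: "u \<in> N \<Longrightarrow> snk u \<Longrightarrow> negate ` cl u \<subseteq> Must u"
begin

definition all_arcs :: "'n rel" where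
  "all_arcs = {(u, ch u b) |u b. u \<in> N \<and> \<not> snk u}"

text \<open>Restricting to nodes reachable from \<open>s\<^sub>0\<close> ensures that no other node
  lacks a predecessor.\<close>

definition nodes :: "'n set" where
  "nodes = {v. (s\<^sub>0, v) \<in> all_arcs\<^sup>*}"

definition dag :: "'n pair_pre_digraph" where
  "dag = \<lparr>pverts = nodes, parcs = {(u, ch u b) |u b. u \<in> nodes \<and> \<not> snk u}\<rparr>"

text \<open>The answer is recovered from the head of the arc; by \<open>ch_distinct\<close> the two
  children of a node cannot be confused.\<close>

definition lab :: "'n \<times> 'n \<Rightarrow> 'v literal" where
  "lab e = answer (var (fst e)) (snd e = ch (fst e) True)"

lemma pverts_dag [simp]: "pverts dag = nodes"
  by (simp add: dag_def)

lemma nodes_subset: "nodes \<subseteq> N"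
proof
  fix v assume "v \<in> nodes"
  then have "(s\<^sub>0, v) \<in> all_arcs\<^sup>*" by (simp add: nodes_def)
  then show "v \<in> N"
    by (induction rule: rtrancl_induct) (auto simp: source_in all_arcs_def ch_in)
qed

lemma source_in_nodes: "s\<^sub>0 \<in> nodes"
  by (simp add: nodes_def)

lemma ch_in_nodes: "u \<in> nodes \<Longrightarrow> \<not> snk u \<Longrightarrow> ch u b \<in> nodes"
  using nodes_subset unfolding nodes_def all_arcs_def by (auto intro: rtrancl_into_rtrancl)

lemma parcs_dag_iff: "(u, v) \<in> parcs dag \<longleftrightarrow> u \<in> nodes \<and> \<not> snk u \<and> (\<exists>b. v = ch u b)"
  by (auto simp: dag_def)

lemma finite_nodes: "finite nodes"
  using nodes_subset finite_N finite_subset by blast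

lemma pair_fin_digraph_dag: "pair_fin_digraph dag"
proof
  have "parcs dag \<subseteq> nodes \<times> nodes"
    using ch_in_nodes by (auto simp: parcs_dag_iff)
  then show "finite (parcs dag)"
    using finite_nodes finite_subset by blast
qed (auto simp: finite_nodes parcs_dag_iff ch_in_nodes)

text \<open>Each arc removes the queried variable from \<open>Avail\<close>, so a directed cycle
  would make \<open>Avail\<close> a proper subset of itself.\<close>

lemma Avail_trancl: "(u, v) \<in> (parcs dag)\<^sup>+ \<Longrightarrow> Avail v \<subset> Avail u"
proof (induction rule: trancl_induct)
  case (base v)
  then show ?case using Avail_ch var_Avail nodes_subset by (fastforce simp: parcs_dag_iff)
next
  case (step v w)
  then have "Avail w \<subseteq> Avail v" using Avail_ch nodes_subset by (fastforce simp: parcs_dag_iff)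
  with step.IH show ?case by blast
qed

lemma acyclic_dag: "acyclic (parcs dag)"
  unfolding acyclic_def using Avail_trancl by blast

lemma in_degree_eq_0_iff:
  assumes "v \<in> nodes"
  shows "in_degree dag v = 0 \<longleftrightarrow> v = s\<^sub>0"
proof -
  \<comment> \<open>\<open>in_degree\<close> is a cardinality, which is also 0 for infinite sets;
    finiteness makes degree 0 mean that there is no predecessor.\<close>
  have "finite (in_arcs dag v)"
    using pair_fin_digraph.pair_finite_arcs[OF pair_fin_digraph_dag] by (simp add: in_arcs_def)
  then have "in_degree dag v = 0 \<longleftrightarrow> (\<forall>u. (u, v) \<notin> parcs dag)"
    by (auto simp: in_degree_def in_arcs_def)
  also have "\<dots> \<longleftrightarrow> v = s\<^sub>0"
  proof
    assume no_pred: "\<forall>u. (u, v) \<notin> parcs dag"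
    have "(s\<^sub>0, v) \<in> all_arcs\<^sup>*" using assms by (simp add: nodes_def)
    then show "v = s\<^sub>0"
    proof (cases rule: rtranclE)
      case (step u)
      then have "(u, v) \<in> parcs dag"
        by (auto simp: all_arcs_def parcs_dag_iff nodes_def)
      with no_pred show ?thesis by blast
    qed simp
  qed (use ch_not_source nodes_subset in \<open>auto simp: parcs_dag_iff\<close>)
  finally show ?thesis .
qed

lemma out_arcs_dag:
  assumes "u \<in> nodes"
  shows "out_arcs dag u = (if snk u then {} else {(u, ch u True), (u, ch u False)})"
proof -
  have "(\<exists>b. v = ch u b) \<longleftrightarrow> v = ch u True \<or> v = ch u False" for v
    by (metis (full_types))
  then show ?thesis using assms by (auto simp: out_arcs_def parcs_dag_iff)
qed

lemma out_degree_dag: "u \<in> nodes \<Longrightarrow> out_degree dag u = (if snk u then 0 else 2)"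
  using ch_distinct nodes_subset by (auto simp: out_degree_def out_arcs_dag)

lemma lab_ch: "u \<in> nodes \<Longrightarrow> \<not> snk u \<Longrightarrow> lab (u, ch u b) = answer (var u) b"
  using ch_distinct[of u] nodes_subset by (cases b) (auto simp: lab_def)

lemma walk_Avail:
  assumes "u \<in> nodes" "set p \<subseteq> parcs dag" "pcas u p v" "w \<in> set (pawalk_verts u p)"
  shows "w \<in> nodes" "Avail w \<subseteq> Avail u"
  using assms
proof (induction p arbitrary: u)
  case (Cons e p)
  { case 1 then show ?case using Cons.IH(1)[of "snd e"] ch_in_nodes
      by (cases e) (auto simp: parcs_dag_iff)
  next
    case 2 then show ?case using Cons.IH(2)[of "snd e"] ch_in_nodes Avail_ch nodes_subset
      by (cases e) (fastforce simp: parcs_dag_iff)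
  }
qed auto

text \<open>This is regularity: a variable queried after leaving \<open>u\<close> belongs to
  \<open>Avail (ch u b)\<close>, from which \<open>var u\<close> has been removed.\<close>

lemma walk_inj_on_var:
  assumes "u \<in> nodes" "set p \<subseteq> parcs dag" "pcas u p v"
  shows "inj_on var {w \<in> set (pawalk_verts u p). \<not> snk w}"
  using assms
proof (induction p arbitrary: u)
  case (Cons e p)
  obtain b where e: "e = (u, ch u b)" and "\<not> snk u"
    using Cons.prems by (cases e) (auto simp: parcs_dag_iff)
  have ch: "ch u b \<in> nodes" using ch_in_nodes Cons.prems(1) \<open>\<not> snk u\<close> by blast
  have walk: "set p \<subseteq> parcs dag" "pcas (ch u b) p v" using Cons.prems by (auto simp: e)
  have neq: "var w \<noteq> var u" if "w \<in> set (pawalk_verts (ch u b) p)" "\<not> snk w" for w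
  proof -
    have "var w \<in> Avail w"
      using walk_Avail(1)[OF ch walk that(1)] that(2) var_Avail nodes_subset by blast
    then show ?thesis
      using walk_Avail(2)[OF ch walk that(1)] Avail_ch[of u b] Cons.prems(1) \<open>\<not> snk u\<close>
        nodes_subset by blast
  qed
  have "inj_on var (insert u {w \<in> set (pawalk_verts (ch u b) p). \<not> snk w})"
    using Cons.IH[OF ch walk] neq by (force simp: inj_on_insert)
  then show ?case by (rule inj_on_subset) (auto simp: e)
qed (auto simp: inj_on_def)

text \<open>Each arc adds at most its own label to \<open>Must\<close>. As \<open>Must\<close> is
  empty at the source, every path from there to \<open>v\<close> carries all literals of
  \<open>Must v\<close> as labels.\<close>

lemma walk_Must:
  assumes "u \<in> nodes" "set p \<subseteq> parcs dag" "pcas u p v"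
  shows "Must v \<subseteq> Must u \<union> lab ` set p"
  using assms
proof (induction p arbitrary: u)
  case (Cons e p)
  obtain b where e: "e = (u, ch u b)" and "\<not> snk u"
    using Cons.prems by (cases e) (auto simp: parcs_dag_iff)
  have "ch u b \<in> nodes" using ch_in_nodes Cons.prems(1) \<open>\<not> snk u\<close> by blast
  then have "Must v \<subseteq> Must (ch u b) \<union> lab ` set p"
    using Cons.IH[of "ch u b"] Cons.prems by (auto simp: e)
  moreover have "Must (ch u b) \<subseteq> insert (lab e) (Must u)"
    using Must_ch[of u b] lab_ch[of u b] Cons.prems(1) \<open>\<not> snk u\<close> nodes_subset by (auto simp: e)
  ultimately show ?case by auto
qed auto

theorem regular_resolution_refutation_dag: "regular_resolution_refutation \<phi> dag var lab cl"
  unfolding regular_resolution_refutation_def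
proof (intro conjI ballI allI impI)
  show "\<exists>!s. s \<in> pverts dag \<and> in_degree dag s = 0"
    using in_degree_eq_0_iff source_in_nodes by auto
next
  fix u assume u: "u \<in> pverts dag" "out_degree dag u \<noteq> 0"
  then have "u \<in> nodes" "\<not> snk u" by (auto simp: out_degree_dag split: if_splits)
  then show "out_degree dag u = 2" "var u \<in> cnf_vars \<phi>"
    "lab ` out_arcs dag u = {Pos (var u), Neg (var u)}"
    using var_in nodes_subset by (auto simp: out_degree_dag out_arcs_dag lab_ch answer_def)
next
  fix u p v assume "pre_digraph.apath dag u p v"
  then have "u \<in> nodes" "set p \<subseteq> parcs dag" "pcas u p v"
    by (auto simp: pre_digraph.apath_def pre_digraph.awalk_def cas_with_proj_eq)
  from walk_inj_on_var[OF this] walk_Avail(1)[OF this]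
  show "inj_on var {w \<in> set (pre_digraph.awalk_verts dag u p). out_degree dag w \<noteq> 0}"
    by (auto simp: awalk_verts_with_proj_eq out_degree_dag inj_on_def split: if_splits)
next
  fix u assume u: "u \<in> pverts dag" "out_degree dag u = 0"
  then have *: "u \<in> N" "snk u" using nodes_subset by (auto simp: out_degree_dag split: if_splits)
  show "cl u \<in> \<phi>" using cl_in * by blast
  fix s p l assume "in_degree dag s = 0 \<and> pre_digraph.apath dag s p u" "l \<in> cl u"
  then have "s \<in> nodes" "set p \<subseteq> parcs dag" "pcas s p u" "s = s\<^sub>0"
    using in_degree_eq_0_iff
    by (auto simp: pre_digraph.apath_def pre_digraph.awalk_def cas_with_proj_eq)
  then show "negate l \<in> lab ` set p"
    using walk_Must[of s p u] Must_source cl_Must[OF *] \<open>l \<in> cl u\<close> by auto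
qed (fact pair_fin_digraph_dag acyclic_dag)+

end

text \<open>The nodes are renamed along an injection \<open>f\<close> into the naturals, and
  \<open>g\<close> decodes them. Passing to reachable nodes can only decrease the size.\<close>

lemma decision_dag_refutation_nat:
  assumes "decision_dag \<phi> (N :: 'n set) s\<^sub>0 ch snk var cl Avail Must"
  shows "\<exists>(R :: nat pair_pre_digraph) var lab cl.
    regular_resolution_refutation \<phi> R var lab cl \<and> card (pverts R) \<le> card N"
proof -
  interpret decision_dag \<phi> N s\<^sub>0 ch snk var cl Avail Must by (fact assms)
  obtain f :: "'n \<Rightarrow> nat" where f: "inj_on f N"
    using finite_imp_inj_to_nat_seg[OF finite_N] by metis
  define g where "g = the_inv_into N f"
  have g: "g (f u) = u" if "u \<in> N" for u
    using f that by (simp add: g_def the_inv_into_f_f)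
  have f_eq: "f u = f v \<longleftrightarrow> u = v" if "u \<in> N" "v \<in> N" for u v
    using f that by (auto simp: inj_on_def)
  interpret enc: decision_dag \<phi> "f ` N" "f s\<^sub>0" "\<lambda>u b. f (ch (g u) b)" "snk \<circ> g" "var \<circ> g"
    "cl \<circ> g" "Avail \<circ> g" "Must \<circ> g"
  proof
    show "u \<in> f ` N \<Longrightarrow> \<not> (snk \<circ> g) u \<Longrightarrow>
      (Avail \<circ> g) (f (ch (g u) b)) \<subseteq> (Avail \<circ> g) u - {(var \<circ> g) u}" for u b
      using Avail_ch[of "g u" b] by (auto simp: g ch_in)
    show "u \<in> f ` N \<Longrightarrow> \<not> (snk \<circ> g) u \<Longrightarrow>
      (Must \<circ> g) (f (ch (g u) b)) \<subseteq> insert (answer ((var \<circ> g) u) b) ((Must \<circ> g) u)" for u b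
      using Must_ch[of "g u" b] by (auto simp: g ch_in)
    show "u \<in> f ` N \<Longrightarrow> (snk \<circ> g) u \<Longrightarrow> negate ` (cl \<circ> g) u \<subseteq> (Must \<circ> g) u" for u
      by (elim imageE) (simp add: g cl_Must)
  qed (auto simp: finite_N source_in g f_eq ch_in ch_not_source ch_distinct var_in var_Avail
      Must_source cl_in)
  have "card enc.nodes \<le> card N"
    using card_mono[OF enc.finite_N enc.nodes_subset] card_image_le[OF finite_N, of f]
    by (rule le_trans)
  then show ?thesis
    by (intro exI conjI) (rule enc.regular_resolution_refutation_dag, simp)
qed

section \<open>Elimination forests\<close>

locale elimination_forest =
  fixes \<phi> :: "'v clauses" and prec :: "'v \<Rightarrow> 'v \<Rightarrow> bool"  (infix \<open>\<prec>\<close> 50)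
  assumes finite_vars: "finite (cnf_vars \<phi>)"
    and prec_in_vars: "y \<prec> x \<Longrightarrow> y \<in> cnf_vars \<phi> \<and> x \<in> cnf_vars \<phi>"
    and prec_irrefl: "\<not> x \<prec> x"
    and prec_trans: "x \<prec> y \<Longrightarrow> y \<prec> z \<Longrightarrow> x \<prec> z"
    and prec_below_linear: "y \<prec> x \<Longrightarrow> z \<prec> x \<Longrightarrow> y = z \<or> y \<prec> z \<or> z \<prec> y"
    and clause_linear: "C \<in> \<phi> \<Longrightarrow> x \<in> atom ` C \<Longrightarrow> y \<in> atom ` C \<Longrightarrow> x = y \<or> x \<prec> y \<or> y \<prec> x"
begin

definition above :: "'v \<Rightarrow> 'v set" where
  "above x = {w \<in> cnf_vars \<phi>. x \<prec> w}"

definition touching :: "'v \<Rightarrow> 'v clauses \<Rightarrow> 'v clauses" where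
  "touching x U = {C \<in> U. atom ` C \<inter> insert x (above x) \<noteq> {}}"

text \<open>Equivalently, \<open>U\<close> is unsatisfiable once all literals over variables outside
  \<open>D\<close> are deleted.\<close>

definition unsat_on :: "'v set \<Rightarrow> 'v clauses \<Rightarrow> bool" where
  "unsat_on D U \<longleftrightarrow> (\<forall>\<tau>. \<exists>C\<in>U. \<forall>l\<in>C. atom l \<in> D \<longrightarrow> \<not> lit_true \<tau> l)"

text \<open>The earlier answers are encoded by a total assignment, of which only the values on
  predecessors of \<open>x\<close> matter.\<close>

definition residual :: "'v \<Rightarrow> ('v \<Rightarrow> bool) \<Rightarrow> 'v clauses" where
  "residual x \<rho> = {C \<in> touching x \<phi>. \<forall>l\<in>C. atom l \<prec> x \<longrightarrow> \<not> lit_true \<rho> l}"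

definition minimal_in :: "'v \<Rightarrow> 'v set \<Rightarrow> bool" where
  "minimal_in z D \<longleftrightarrow> z \<in> D \<and> (\<forall>w\<in>D. \<not> w \<prec> z)"

lemma minimal_below:
  assumes "D \<subseteq> cnf_vars \<phi>" "w \<in> D"
  shows "\<exists>z. minimal_in z D \<and> (z = w \<or> z \<prec> w)"
proof -
  let ?r = "{(y, x). y \<prec> x}"
  have "?r \<subseteq> cnf_vars \<phi> \<times> cnf_vars \<phi>" using prec_in_vars by auto
  then have "finite ?r" using finite_vars finite_subset by blast
  moreover have "trans ?r" using prec_trans by (auto intro: transI)
  then have "acyclic ?r" using prec_irrefl by (simp add: acyclic_def trancl_id)
  ultimately have "wf ?r" by (rule finite_acyclic_wf)
  then obtain z where "z \<in> {v \<in> D. v = w \<or> v \<prec> w}"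
    and "\<And>y. y \<prec> z \<Longrightarrow> y \<notin> {v \<in> D. v = w \<or> v \<prec> w}"
    using wfE_min[of ?r w "{v \<in> D. v = w \<or> v \<prec> w}"] assms(2) by auto
  then show ?thesis using prec_trans unfolding minimal_in_def by blast
qed

text \<open>The subtrees of the minimal elements of \<open>D\<close> are disjoint, so satisfying assignments of the
  parts could be glued.\<close>

lemma unsat_on_splits:
  assumes D: "D \<subseteq> cnf_vars \<phi>" "\<And>w v. w \<in> D \<Longrightarrow> w \<prec> v \<Longrightarrow> v \<in> D"
    and unsat: "unsat_on D U"
    and touch: "\<And>C. C \<in> U \<Longrightarrow> atom ` C \<inter> D \<noteq> {}"
  shows "\<exists>z. minimal_in z D \<and> unsat_on (insert z (above z)) (touching z U)"
proof (rule ccontr)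
  assume contra: "\<not> ?thesis"
  have "\<exists>\<tau>. \<forall>C\<in>touching z U. \<exists>l\<in>C. atom l \<in> insert z (above z) \<and> lit_true \<tau> l"
    if "minimal_in z D" for z
  proof -
    have "\<not> unsat_on (insert z (above z)) (touching z U)" using contra that by simp
    then show ?thesis by (simp add: unsat_on_def del: insert_iff)
  qed
  then obtain \<tau> where \<tau>: "\<And>z C. minimal_in z D \<Longrightarrow> C \<in> touching z U \<Longrightarrow>
      \<exists>l\<in>C. atom l \<in> insert z (above z) \<and> lit_true (\<tau> z) l"
    by (metis (no_types, lifting))
  \<comment> \<open>\<open>rt w\<close> is the root of the subtree containing \<open>w\<close>. It
    is unique because elements below \<open>w\<close> are comparable and distinct minimal elements
    are not.\<close>
  define rt where "rt w = (SOME z. minimal_in z D \<and> w \<in> insert z (above z))" for w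
  have rt: "rt w = z" if "minimal_in z D" "w \<in> insert z (above z)" for w z
    unfolding rt_def
  proof (rule some_equality)
    fix z' assume "minimal_in z' D \<and> w \<in> insert z' (above z')"
    then show "z' = z" using that prec_below_linear[of z w z']
      by (auto simp: minimal_in_def above_def)
  qed (use that in blast)
  \<comment> \<open>The assignment glued from the parts gives \<open>w\<close> the value it has
    under \<open>\<tau> (rt w)\<close>. It has to falsify some \<open>C\<close> on \<open>D\<close>,
    yet \<open>C\<close> meets a subtree whose own assignment satisfies it there.\<close>
  obtain C where C: "C \<in> U" "\<And>l. l \<in> C \<Longrightarrow> atom l \<in> D \<Longrightarrow> \<not> lit_true (\<lambda>w. \<tau> (rt w) w) l"
    using unsat unfolding unsat_on_def by (metis (no_types, lifting))
  obtain w where w: "w \<in> atom ` C" "w \<in> D" using touch[OF C(1)] by blast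
  obtain z where z: "minimal_in z D" "z = w \<or> z \<prec> w" using minimal_below[OF D(1) w(2)] by blast
  then have "C \<in> touching z U"
    using C(1) w D(1) by (auto simp: touching_def above_def)
  then obtain l where l: "l \<in> C" "atom l \<in> insert z (above z)" "lit_true (\<tau> z) l"
    using \<tau> z(1) by blast
  then have "atom l \<in> D" using z(1) D(2) by (auto simp: minimal_in_def above_def)
  moreover have "lit_true (\<lambda>w. \<tau> (rt w) w) l"
    using l(3) rt[OF z(1) l(2)] by (subst lit_true_cong[where \<beta> = "\<tau> z"]) auto
  ultimately show False using C(2) l(1) by blast
qed

section \<open>Residual clause sets along a branch of the forest\<close>

text \<open>Such a \<open>z\<close> is a child of \<open>x\<close> in the forest. A predecessor of
  \<open>z\<close> is comparable with \<open>x\<close> and by minimality cannot lie strictly above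
  it.\<close>

lemma prec_minimal_above:
  assumes "minimal_in z (above x)"
  shows "y \<prec> z \<longleftrightarrow> y = x \<or> y \<prec> x"
proof
  assume "y \<prec> z"
  moreover have "x \<prec> z" using assms by (auto simp: minimal_in_def above_def)
  ultimately show "y = x \<or> y \<prec> x"
    using prec_below_linear[of y z x] assms prec_in_vars[of x y]
    by (auto simp: minimal_in_def above_def)
next
  assume "y = x \<or> y \<prec> x"
  moreover have "x \<prec> z" using assms by (auto simp: minimal_in_def above_def)
  ultimately show "y \<prec> z" using prec_trans by blast
qed

lemma minimal_subtree:
  assumes "minimal_in z (above x)"
  shows "insert z (above z) \<subseteq> above x"
  using assms prec_trans by (auto simp: minimal_in_def above_def)

lemma residual_root:
  assumes "minimal_in z (cnf_vars \<phi>)"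
  shows "touching z \<phi> = residual z \<rho>"
  using assms prec_in_vars by (fastforce simp: residual_def minimal_in_def)

text \<open>This keeps the states of the search in the range of \<open>residual\<close>: moving to a
  child \<open>z\<close> adds only \<open>x\<close> to the predecessors, so recording the answer
  \<open>b\<close> in the assignment suffices.\<close>

lemma residual_step:
  assumes "minimal_in z (above x)"
  shows "touching z {C \<in> residual x \<rho>. answer x b \<notin> C} = residual z (\<rho>(x := b))"
proof -
  have touch: "C \<in> touching z \<phi> \<Longrightarrow> C \<in> touching x \<phi>" for C
    using minimal_subtree[OF assms] by (auto simp: touching_def)
  have "(\<forall>l\<in>C. atom l \<prec> z \<longrightarrow> \<not> lit_true (\<rho>(x := b)) l) \<longleftrightarrow>
      answer x b \<notin> C \<and> (\<forall>l\<in>C. atom l \<prec> x \<longrightarrow> \<not> lit_true \<rho> l)" for C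
  proof -
    have "lit_true (\<rho>(x := b)) l = lit_true \<rho> l" if "atom l \<prec> x" for l
      using that prec_irrefl by (intro lit_true_cong) auto
    moreover have "atom (answer x b) = x" by (simp add: answer_def)
    ultimately show ?thesis
      unfolding prec_minimal_above[OF assms] by (metis lit_true_fun_upd_same)
  qed
  then show ?thesis using touch by (auto simp: residual_def touching_def)
qed

text \<open>Any \<tau> can be changed to take the value \<open>b\<close> at \<open>x\<close>. A
  clause falsified by the changed assignment cannot contain \<open>answer x b\<close>, and it is
  falsified by \<tau> on \<open>above x\<close>.\<close>

lemma unsat_on_restrict:
  assumes "unsat_on (insert x (above x)) U"
  shows "unsat_on (above x) {C \<in> U. answer x b \<notin> C}"
  unfolding unsat_on_def
proof
  fix \<tau>
  obtain C where C: "C \<in> U"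
    "\<And>l. l \<in> C \<Longrightarrow> atom l \<in> insert x (above x) \<Longrightarrow> \<not> lit_true (\<tau>(x := b)) l"
    using assms unfolding unsat_on_def by (metis (no_types, lifting))
  have "answer x b \<notin> C"
    using C(2)[of "answer x b"] lit_true_answer[of "\<tau>(x := b)" x b] by (auto simp: answer_def)
  moreover have "\<not> lit_true \<tau> l" if "l \<in> C" "atom l \<in> above x" for l
  proof -
    have "atom l \<noteq> x" using that(2) prec_irrefl by (auto simp: above_def)
    then show ?thesis using C(2)[OF that(1)] that(2) lit_true_cong[of "\<tau>(x := b)" l \<tau>] by auto
  qed
  ultimately show "\<exists>C\<in>{C \<in> U. answer x b \<notin> C}. \<forall>l\<in>C. atom l \<in> above x \<longrightarrow> \<not> lit_true \<tau> l"
    using C(1) by blast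
qed

text \<open>The node \<open>Some ((x, U), b)\<close> is reached by answering \<open>b\<close> to the query of \<open>x\<close> when the clauses in
  \<open>U\<close> are still alive, \<open>None\<close> is the source. Remembering the answered query keeps the two children
  of a node distinct and makes it unnecessary to count the sinks separately.\<close>

type_synonym 'w node = "(('w \<times> 'w clauses) \<times> bool) option"

fun avail :: "'v node \<Rightarrow> 'v set" where
  "avail None = cnf_vars \<phi>"
| "avail (Some ((x, U), b)) = above x"

fun alive :: "'v node \<Rightarrow> 'v clauses" where
  "alive None = \<phi>"
| "alive (Some ((x, U), b)) = {C \<in> U. answer x b \<notin> C}"

text \<open>A clause still in \<open>U\<close> has had all its literals on predecessors of
  \<open>x\<close> falsified. The state thus determines labels that occur on every path to it,
  however it was reached.\<close>

fun must :: "'v node \<Rightarrow> 'v literal set" where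
  "must None = {}"
| "must (Some ((x, U), b)) = insert (answer x b) (negate ` {l \<in> \<Union>U. atom l \<prec> x})"

definition is_sink :: "'v node \<Rightarrow> bool" where
  "is_sink u \<longleftrightarrow> (\<exists>C\<in>alive u. atom ` C \<inter> avail u = {})"

definition sink_clause :: "'v node \<Rightarrow> 'v clause" where
  "sink_clause u = (SOME C. C \<in> alive u \<and> atom ` C \<inter> avail u = {})"

definition query :: "'v node \<Rightarrow> 'v" where
  "query u = (SOME z. minimal_in z (avail u) \<and>
     unsat_on (insert z (above z)) (touching z (alive u)))"

definition child :: "'v node \<Rightarrow> bool \<Rightarrow> 'v node" where
  "child u b = Some ((query u, touching (query u) (alive u)), b)"

text \<open>Unsatisfiability is the invariant that guarantees a next query; membership in the range
  of \<open>residual\<close> is what makes the states countable.\<close>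

definition queries :: "('v \<times> 'v clauses) set" where
  "queries = {(x, U). x \<in> cnf_vars \<phi> \<and> unsat_on (insert x (above x)) U \<and> U \<in> range (residual x)}"

definition all_nodes :: "'v node set" where
  "all_nodes = insert None (Some ` (queries \<times> UNIV))"

lemma all_nodes_cases [consumes 1, case_names source answered]:
  assumes "u \<in> all_nodes"
  obtains "u = None"
  | x \<rho> b where "u = Some ((x, residual x \<rho>), b)" "x \<in> cnf_vars \<phi>"
      "unsat_on (insert x (above x)) (residual x \<rho>)"
  using assms unfolding all_nodes_def queries_def by blast

lemma sink_clause:
  assumes "is_sink u"
  shows "sink_clause u \<in> alive u" "atom ` sink_clause u \<inter> avail u = {}"
  using assms someI_ex[of "\<lambda>C. C \<in> alive u \<and> atom ` C \<inter> avail u = {}"]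
  unfolding is_sink_def sink_clause_def by blast+

section \<open>Invariants of the search and its size\<close>

context
  assumes unsat: "\<not> satisfiable \<phi>"
begin

text \<open>At a non-sink every alive clause has an available variable, so
  \<open>unsat_on_splits\<close> provides a candidate for the choice in
  \<open>query\<close>.\<close>

lemma query:
  assumes "u \<in> all_nodes" "\<not> is_sink u"
  shows "minimal_in (query u) (avail u)"
    "unsat_on (insert (query u) (above (query u))) (touching (query u) (alive u))"
proof -
  have "\<exists>z. minimal_in z (avail u) \<and> unsat_on (insert z (above z)) (touching z (alive u))"
  proof (rule unsat_on_splits)
    show "avail u \<subseteq> cnf_vars \<phi>"
      by (cases u rule: avail.cases) (auto simp: above_def)
    show "v \<in> avail u" if "w \<in> avail u" "w \<prec> v" for w v
      using that prec_trans prec_in_vars by (cases u rule: avail.cases) (auto simp: above_def)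
    show "unsat_on (avail u) (alive u)"
      using assms(1)
    proof (cases rule: all_nodes_cases)
      case source
      then show ?thesis using unsat unfolding unsat_on_def satisfiable_def by simp blast
    next
      case answered
      then show ?thesis using unsat_on_restrict by simp
    qed
    show "atom ` C \<inter> avail u \<noteq> {}" if "C \<in> alive u" for C
      using that assms(2) by (auto simp: is_sink_def)
  qed
  from someI_ex[OF this] show "minimal_in (query u) (avail u)"
    "unsat_on (insert (query u) (above (query u))) (touching (query u) (alive u))"
    unfolding query_def by blast+
qed

lemma query_in_vars:
  assumes "u \<in> all_nodes" "\<not> is_sink u"
  shows "query u \<in> cnf_vars \<phi>"
  using query(1)[OF assms] by (cases u rule: avail.cases) (auto simp: minimal_in_def above_def)

lemma child_in_all_nodes:
  assumes "u \<in> all_nodes" "\<not> is_sink u"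
  shows "child u b \<in> all_nodes"
proof -
  have "touching (query u) (alive u) \<in> range (residual (query u))"
    using assms(1)
  proof (cases rule: all_nodes_cases)
    case source
    then show ?thesis using residual_root query(1)[OF assms] by simp
  next
    case (answered x \<rho> b)
    then show ?thesis using residual_step[of "query u" x \<rho> b] query(1)[OF assms] by simp
  qed
  then show ?thesis
    using query(2)[OF assms] query_in_vars[OF assms]
    by (auto simp: child_def all_nodes_def queries_def)
qed

text \<open>The predecessors of the new query are the last queried \<open>x\<close> and its
  predecessors. An alive clause contains on \<open>x\<close> only the literal opposite to the
  answer; its literals on earlier variables are already accounted for in
  \<open>must u\<close>.\<close>

lemma must_child:
  assumes "u \<in> all_nodes" "\<not> is_sink u"
  shows "must (child u b) \<subseteq> insert (answer (query u) b) (must u)"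
proof -
  have "negate l \<in> must u" if l: "l \<in> C" "C \<in> alive u" "atom l \<prec> query u" for l C
    using assms(1)
  proof (cases rule: all_nodes_cases)
    case source
    then show ?thesis using query(1)[OF assms] l prec_in_vars by (auto simp: minimal_in_def)
  next
    case (answered x \<rho> b)
    then have "atom l = x \<or> atom l \<prec> x"
      using l(3) query(1)[OF assms] prec_minimal_above by simp
    then show ?thesis
    proof
      assume "atom l = x"
      then have "negate l = answer x b"
        using l answered by (intro negate_eq_answer) auto
      then show ?thesis using answered by simp
    qed (use l answered in auto)
  qed
  then show ?thesis by (auto simp: child_def touching_def)
qed

text \<open>The variables of a clause form a chain. If the clause contains \<open>x\<close> and
  nothing above \<open>x\<close>, all its other variables precede \<open>x\<close> and were answered
  against it.\<close>

lemma sink_clause_must: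
  assumes "u \<in> all_nodes" "is_sink u"
  shows "sink_clause u \<in> \<phi>" "negate ` sink_clause u \<subseteq> must u"
proof -
  let ?C = "sink_clause u"
  note C = sink_clause[OF assms(2)]
  have "?C \<in> \<phi> \<and> negate ` ?C \<subseteq> must u"
    using assms(1)
  proof (cases rule: all_nodes_cases)
    \<comment> \<open>At the source all variables are available, so the sink clause is
      empty.\<close>
    case source
    then show ?thesis using C by (auto simp: cnf_vars_def)
  next
    case (answered x \<rho> b)
    \<comment> \<open>The clause touches the subtree of \<open>x\<close> but has no variable in
      \<open>above x\<close>; hence \<open>x\<close> itself occurs in it.\<close>
    then have phi: "?C \<in> \<phi>" and ans: "answer x b \<notin> ?C" and x: "x \<in> atom ` ?C"
      using C by (auto simp: residual_def touching_def)
    have "negate l \<in> must u" if "l \<in> ?C" for l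
    proof -
      have "\<not> x \<prec> atom l" using C(2) answered that atom_in_vars[OF phi imageI[OF that]]
        by (auto simp: above_def)
      then have "atom l = x \<or> atom l \<prec> x" using clause_linear[OF phi x] that by blast
      then show ?thesis
      proof
        assume "atom l = x"
        then have "negate l = answer x b"
          using that ans by (intro negate_eq_answer) auto
        then show ?thesis using answered by simp
      qed (use C(1) that answered in auto)
    qed
    then show ?thesis using phi by blast
  qed
  then show "?C \<in> \<phi>" "negate ` ?C \<subseteq> must u" by auto
qed

text \<open>Each pair of a variable and a residual set contributes one node per answer, and the
  source adds one more.\<close>

lemma refutation:
  assumes fin: "\<And>x. x \<in> cnf_vars \<phi> \<Longrightarrow> finite (range (residual x))"
    and bound: "\<And>x. x \<in> cnf_vars \<phi> \<Longrightarrow> card (range (residual x)) \<le> M"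
  shows "\<exists>(R :: nat pair_pre_digraph) var lab cl. regular_resolution_refutation \<phi> R var lab cl \<and>
    card (pverts R) \<le> 1 + 2 * card (cnf_vars \<phi>) * M"
proof -
  let ?Q = "SIGMA x:cnf_vars \<phi>. range (residual x)"
  have fin_Q: "finite ?Q" and sub: "queries \<subseteq> ?Q"
    using finite_vars fin by (auto simp: queries_def)
  then have fin_queries: "finite queries" using finite_subset by blast
  have "card queries \<le> card ?Q" using card_mono fin_Q sub by blast
  also have "\<dots> = (\<Sum>x\<in>cnf_vars \<phi>. card (range (residual x)))"
    using finite_vars fin by (intro card_SigmaI) auto
  also have "\<dots> \<le> card (cnf_vars \<phi>) * M"
    using sum_bounded_above[of "cnf_vars \<phi>" "\<lambda>x. card (range (residual x))" M] bound by simp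
  finally have "card queries \<le> card (cnf_vars \<phi>) * M" .
  moreover have "card all_nodes \<le> 1 + 2 * card queries"
  proof -
    have "card all_nodes \<le> 1 + card (Some ` (queries \<times> (UNIV :: bool set)))"
      unfolding all_nodes_def using fin_queries by (simp add: card_insert_if)
    also have "\<dots> = 1 + 2 * card queries"
      by (simp add: card_image card_cartesian_product)
    finally show ?thesis .
  qed
  ultimately have card: "card all_nodes \<le> 1 + 2 * card (cnf_vars \<phi>) * M" by simp
  have "decision_dag \<phi> all_nodes None child is_sink query sink_clause avail must"
  proof
    show "finite all_nodes" using fin_queries by (simp add: all_nodes_def)
    show "avail (child u b) \<subseteq> avail u - {query u}" if u: "u \<in> all_nodes" "\<not> is_sink u" for u b
      using query(1)[OF u] prec_irrefl prec_trans
      by (cases u rule: avail.cases) (auto simp: child_def minimal_in_def above_def)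
  qed (use query query_in_vars child_in_all_nodes must_child sink_clause_must in
      \<open>auto simp: all_nodes_def child_def minimal_in_def\<close>)
  from decision_dag_refutation_nat[OF this] card show ?thesis
    by (meson le_trans)
qed

end

end

section \<open>Rooted trees\<close>

locale rooted_tree_arcs =
  fixes T :: "'t pair_pre_digraph" and r :: 't
  assumes rooted: "rooted_tree T r"
begin

abbreviation anc :: "'t \<Rightarrow> 't \<Rightarrow> bool"  (infix \<open>\<unlhd>\<close> 50) where
  "a \<unlhd> t \<equiv> (a, t) \<in> (parcs T)\<^sup>*"

lemma fin: "pair_fin_digraph T"
  using rooted by (simp add: rooted_tree_def)

lemma finite_in_arcs: "finite (in_arcs T t)"
  using pair_fin_digraph.pair_finite_arcs[OF fin] by (simp add: in_arcs_def)

lemma no_parent_root: "(a, r) \<notin> parcs T"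
  using rooted finite_in_arcs[of r] by (auto simp: rooted_tree_def in_degree_def in_arcs_def)

lemma parent_unique:
  assumes "(a, t) \<in> parcs T" "(b, t) \<in> parcs T"
  shows "a = b"
proof -
  have "t \<in> pverts T - {r}"
    using assms no_parent_root pair_wf_digraph.in_arcsD2[of T a t] fin
    by (auto simp: pair_fin_digraph_def)
  then have "card (in_arcs T t) = 1" using rooted by (auto simp: rooted_tree_def in_degree_def)
  then obtain e where "in_arcs T t = {e}" by (auto simp: card_1_singleton_iff)
  moreover have "(a, t) \<in> in_arcs T t" "(b, t) \<in> in_arcs T t"
    using assms by (auto simp: in_arcs_def)
  ultimately show ?thesis by auto
qed

section \<open>The ancestor order\<close>

lemma anc_parent:
  assumes "a \<unlhd> t" "(s, t) \<in> parcs T"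
  shows "a = t \<or> a \<unlhd> s"
  using assms(1)
proof (cases rule: rtranclE)
  case (step u)
  then show ?thesis using parent_unique[OF assms(2)] by auto
qed simp

text \<open>Since parents are unique, the ancestors of a node form a chain.\<close>

lemma anc_linear: "a \<unlhd> t \<Longrightarrow> b \<unlhd> t \<Longrightarrow> a \<unlhd> b \<or> b \<unlhd> a"
proof (induction rule: rtrancl_induct)
  case (step s t)
  have "a \<unlhd> t" using step(1,2) by (rule rtrancl_into_rtrancl)
  then show ?case using anc_parent[OF step.prems step(2)] step.IH by blast
qed simp

text \<open>A cycle would contain all ancestors of its nodes, hence the root.\<close>

lemma acyclic_tree: "acyclic (parcs T)"
  unfolding acyclic_def
proof (intro allI notI)
  fix t assume cycle: "(t, t) \<in> (parcs T)\<^sup>+"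
  then have "t \<in> pverts T"
    using fin by (auto dest!: tranclD2 intro: pair_wf_digraph.in_arcsD2 simp: pair_fin_digraph_def)
  then have "r \<unlhd> t"
    using rooted reachable_rtranclI[of T r t] by (auto simp: rooted_tree_def)
  then have "(r, r) \<in> (parcs T)\<^sup>+"
    using cycle
  proof (induction rule: converse_rtrancl_induct)
    \<comment> \<open>A cycle through \<open>u\<close> enters it from its only parent
      \<open>s\<close>, so it passes through \<open>s\<close> as well.\<close>
    case (step s u)
    then have "(u, u) \<in> (parcs T)\<^sup>+" by blast
    then obtain v where "u \<unlhd> v" "(v, u) \<in> parcs T" by (meson tranclD2)
    then show ?case using step(1) parent_unique[of s u v] by (auto intro: rtrancl_into_trancl2)
  qed
  then show False using no_parent_root by (meson tranclE)
qed

lemma anc_antisym: "a \<unlhd> b \<Longrightarrow> b \<unlhd> a \<Longrightarrow> a = b"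
  using acyclic_tree by (meson acyclic_impl_antisym_rtrancl antisymD)

lemma wf_arcs: "wf ((parcs T)\<^sup>+)"
  using finite_acyclic_wf[OF _ acyclic_tree] pair_fin_digraph.pair_finite_arcs[OF fin]
  by (intro wf_trancl)

text \<open>Connectivity ignores directions. Starting at a node \<open>t\<close> of \<open>W\<close>
  without proper ancestors in \<open>W\<close>, an undirected walk inside \<open>W\<close> only
  reaches nodes to which a directed path inside \<open>W\<close> leads.\<close>

lemma connected_top:
  assumes "connected (with_proj T \<restriction> W)"
  shows "\<exists>t\<in>W. \<forall>s\<in>W. (t, s) \<in> (parcs T \<inter> W \<times> W)\<^sup>*"
proof -
  let ?S = "mk_symmetric (with_proj T \<restriction> W)"
  have conn: "W \<noteq> {}" "\<And>u v. u \<in> W \<Longrightarrow> v \<in> W \<Longrightarrow> (u, v) \<in> (parcs ?S)\<^sup>*"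
    using assms reachable_rtranclI[of "with_proj ?S"]
    by (auto simp: connected_def strongly_connected_def)
  have sym_arc: "a \<in> W \<and> b \<in> W \<and> ((a, b) \<in> parcs T \<or> (b, a) \<in> parcs T)"
    if "(a, b) \<in> parcs ?S" for a b
    using that by (auto simp: parcs_mk_symmetric induce_subgraph_def)
  obtain t where t: "t \<in> W" "\<And>s. (s, t) \<in> (parcs T)\<^sup>+ \<Longrightarrow> s \<notin> W"
    using wfE_min'[OF wf_arcs conn(1)] by metis
  have "(t, s) \<in> (parcs T \<inter> W \<times> W)\<^sup>*" if "s \<in> W" for s
    using conn(2)[OF t(1) that]
  proof (induction rule: rtrancl_induct)
    case (step u v)
    note uv = sym_arc[OF step(2)]
    show ?case
    proof (cases "(u, v) \<in> parcs T")
      case True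
      then show ?thesis using uv step.IH by (auto intro: rtrancl_into_rtrancl)
    next
      case False
      \<comment> \<open>The walk goes up from \<open>u\<close> to its parent \<open>v\<close>. As
        \<open>u\<close> is not \<open>t\<close>, the directed path to \<open>u\<close> has a last
        arc, which must come from \<open>v\<close>.\<close>
      with uv have vu: "(v, u) \<in> parcs T" by blast
      with t uv have "u \<noteq> t" by blast
      with step.IH obtain w where w: "(t, w) \<in> (parcs T \<inter> W \<times> W)\<^sup>*" "(w, u) \<in> parcs T"
        by (metis IntD1 rtranclE)
      then show ?thesis using parent_unique[OF vu w(2)] by simp
    qed
  qed simp
  with t(1) show ?thesis by blast
qed

text \<open>By uniqueness of parents, the ancestors of \<open>s\<close> below \<open>t\<close> are
  the nodes of the path from \<open>t\<close> to \<open>s\<close>, which stays inside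
  \<open>W\<close>.\<close>

lemma top_convex:
  assumes "(t, s) \<in> (parcs T \<inter> W \<times> W)\<^sup>*" "t \<in> W" "t \<unlhd> u" "u \<unlhd> s"
  shows "u \<in> W"
  using assms(1,4)
proof (induction rule: rtrancl_induct)
  case base
  then show ?case using assms(2,3) anc_antisym by blast
next
  case (step s' s)
  then show ?case using anc_parent[of u s s'] by auto
qed

text \<open>The last node of the path lies below all others.\<close>

lemma directed_path_bottom:
  assumes "induces_directed_path T W"
  shows "\<exists>b. \<forall>s\<in>W. s \<unlhd> b"
proof -
  let ?H = "with_proj T \<restriction> W"
  obtain u p b where path: "pre_digraph.apath ?H u p b"
    "set (pre_digraph.awalk_verts ?H u p) = verts ?H"
    using assms by (auto simp: induces_directed_path_def Let_def)
  have "s \<unlhd> b" if "set p \<subseteq> parcs T" "pre_digraph.cas ?H u p b"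
    "s \<in> set (pre_digraph.awalk_verts ?H u p)" for s
    using that
  proof (induction p arbitrary: u s)
    case (Cons e p)
    have hd: "snd e \<in> set (pre_digraph.awalk_verts ?H (snd e) p)"
      using Cons.prems(2)
      by (cases p) (auto simp: pre_digraph.awalk_verts.simps pre_digraph.cas.simps)
    have tl: "set p \<subseteq> parcs T" "pre_digraph.cas ?H (snd e) p b"
      using Cons.prems by (auto simp: pre_digraph.cas.simps)
    have "(fst e, snd e) \<in> parcs T" using Cons.prems(1) by simp
    then have "fst e \<unlhd> b" using Cons.IH[OF tl hd] by (rule converse_rtrancl_into_rtrancl)
    then show ?case
      using Cons.IH[OF tl] Cons.prems(3) by (auto simp: pre_digraph.awalk_verts.simps)
  qed (simp add: pre_digraph.awalk_verts.simps pre_digraph.cas.simps)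
  with path show ?thesis
    by (auto simp: pre_digraph.apath_def pre_digraph.awalk_def)
qed

end

section \<open>The elimination forest of a one-sided tree decomposition\<close>

locale one_sided_decomposition = rooted_tree_arcs T r
  for T :: "'t pair_pre_digraph" and r +
  fixes \<phi> :: "'v clauses" and B :: "'t \<Rightarrow> ('v + 'v clause) set"
  assumes cnf: "cnf \<phi>"
    and decomposition: "tree_decomposition (incidence_graph \<phi>) T r B"
    and sided: "one_sided \<phi> T B"
begin

lemma finite_cnf_vars: "finite (cnf_vars \<phi>)"
  using cnf by (auto simp: cnf_def cnf_vars_def)

lemma finite_bag: "t \<in> pverts T \<Longrightarrow> finite (B t)"
  using decomposition finite_cnf_vars cnf
  by (auto simp: tree_decomposition_def incidence_graph_def cnf_def intro: finite_subset)

text \<open>Requiring the paths from the top to stay among the bag nodes is more than ancestry; this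
  is what \<open>bag_convex\<close> rests on.\<close>

definition top :: "'v + 'v clause \<Rightarrow> 't" where
  "top v = (SOME t. t \<in> bag_nodes T B v \<and>
     (\<forall>s\<in>bag_nodes T B v. (t, s) \<in> (parcs T \<inter> bag_nodes T B v \<times> bag_nodes T B v)\<^sup>*))"

lemma top:
  assumes "v \<in> pverts (incidence_graph \<phi>)"
  shows "top v \<in> bag_nodes T B v"
    "s \<in> bag_nodes T B v \<Longrightarrow> (top v, s) \<in> (parcs T \<inter> bag_nodes T B v \<times> bag_nodes T B v)\<^sup>*"
proof -
  have "connected (with_proj T \<restriction> bag_nodes T B v)"
    using decomposition assms by (auto simp: tree_decomposition_def)
  then have "\<exists>t. t \<in> bag_nodes T B v \<and>
      (\<forall>s\<in>bag_nodes T B v. (t, s) \<in> (parcs T \<inter> bag_nodes T B v \<times> bag_nodes T B v)\<^sup>*)"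
    using connected_top by blast
  from someI_ex[OF this] show "top v \<in> bag_nodes T B v"
    "s \<in> bag_nodes T B v \<Longrightarrow> (top v, s) \<in> (parcs T \<inter> bag_nodes T B v \<times> bag_nodes T B v)\<^sup>*"
    unfolding top_def by blast+
qed

lemma top_anc:
  assumes "v \<in> pverts (incidence_graph \<phi>)" "s \<in> bag_nodes T B v"
  shows "top v \<unlhd> s"
  using top(2)[OF assms] by (rule rtrancl_mono[THEN subsetD, rotated]) blast

lemma bag_convex:
  assumes "v \<in> pverts (incidence_graph \<phi>)" "s \<in> bag_nodes T B v" "top v \<unlhd> u" "u \<unlhd> s"
  shows "u \<in> bag_nodes T B v"
  using top_convex[OF top(2)[OF assms(1,2)] top(1)[OF assms(1)] assms(3,4)] .

lemma var_in_graph: "x \<in> cnf_vars \<phi> \<Longrightarrow> Inl x \<in> pverts (incidence_graph \<phi>)"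
  by (simp add: incidence_graph_def)

lemma clause_in_graph: "C \<in> \<phi> \<Longrightarrow> Inr C \<in> pverts (incidence_graph \<phi>)"
  by (simp add: incidence_graph_def)

lemma common_bag:
  assumes "C \<in> \<phi>" "x \<in> atom ` C"
  shows "\<exists>s. s \<in> bag_nodes T B (Inl x) \<and> s \<in> bag_nodes T B (Inr C)"
proof -
  have "(Inl x, Inr C) \<in> parcs (incidence_graph \<phi>)"
    using assms by (auto simp: incidence_graph_def)
  then show ?thesis using decomposition by (fastforce simp: tree_decomposition_def bag_nodes_def)
qed

section \<open>The order on the variables\<close>

text \<open>An arbitrary numbering that breaks ties between variables with the same topmost
  bag.\<close>

definition idx :: "'v \<Rightarrow> nat" where
  "idx = (SOME f. inj_on f (cnf_vars \<phi>))"

lemma inj_on_idx: "inj_on idx (cnf_vars \<phi>)"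
proof -
  have "\<exists>f :: 'v \<Rightarrow> nat. inj_on f (cnf_vars \<phi>)"
    using finite_imp_inj_to_nat_seg[OF finite_cnf_vars] by metis
  then show ?thesis unfolding idx_def by (rule someI_ex)
qed

definition before :: "'v \<Rightarrow> 'v \<Rightarrow> bool" where
  "before y x \<longleftrightarrow> y \<in> cnf_vars \<phi> \<and> x \<in> cnf_vars \<phi> \<and> top (Inl y) \<unlhd> top (Inl x) \<and>
     (top (Inl y) = top (Inl x) \<longrightarrow> idx y < idx x)"

text \<open>Two ancestors of \<open>t\<close> are comparable, and if the tops coincide, the
  injective numbering decides.\<close>

lemma before_linear:
  assumes "x \<in> cnf_vars \<phi>" "y \<in> cnf_vars \<phi>" "top (Inl x) \<unlhd> t" "top (Inl y) \<unlhd> t"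
  shows "x = y \<or> before x y \<or> before y x"
proof -
  consider "x = y" | "idx x < idx y" | "idx y < idx x"
    using inj_onD[OF inj_on_idx _ assms(1,2)] by linarith
  then show ?thesis
    using anc_linear[OF assms(3,4)] assms(1,2) by cases (auto simp: before_def)
qed

sublocale elimination_forest \<phi> before
proof
  show "finite (cnf_vars \<phi>)" by (fact finite_cnf_vars)
  show "before y x \<Longrightarrow> y \<in> cnf_vars \<phi> \<and> x \<in> cnf_vars \<phi>" for x y by (simp add: before_def)
  show "\<not> before x x" for x by (simp add: before_def)
  show "before x z" if "before x y" "before y z" for x y z
    using that anc_antisym[of "top (Inl x)" "top (Inl y)"]
    by (auto simp: before_def intro: rtrancl_trans)
  show "y = z \<or> before y z \<or> before z y" if "before y x" "before z x" for x y z
    using that before_linear by (auto simp: before_def)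
  show "x = y \<or> before x y \<or> before y x"
    if C: "C \<in> \<phi>" and xy: "x \<in> atom ` C" "y \<in> atom ` C" for C x y
  proof -
    \<comment> \<open>One-sidedness gives a node \<open>b\<close> below all bags containing
      \<open>C\<close>. Every variable of \<open>C\<close> shares a bag with \<open>C\<close>, so
      its top is an ancestor of \<open>b\<close>.\<close>
    obtain b where b: "\<And>s. s \<in> bag_nodes T B (Inr C) \<Longrightarrow> s \<unlhd> b"
      using directed_path_bottom sided C unfolding one_sided_def by metis
    have "top (Inl z) \<unlhd> b" if z: "z \<in> atom ` C" for z
    proof -
      obtain s where s: "s \<in> bag_nodes T B (Inl z)" "s \<in> bag_nodes T B (Inr C)"
        using common_bag[OF C z] by blast
      then have "top (Inl z) \<unlhd> s" using top_anc var_in_graph atom_in_vars[OF C z] by blast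
      also have "s \<unlhd> b" by (rule b) (fact s)
      finally show ?thesis .
    qed
    then show ?thesis using before_linear xy atom_in_vars[OF C] by blast
  qed
qed

section \<open>Counting residual sets through the topmost bag\<close>

text \<open>Let \<open>s\<close> be a bag shared by \<open>y\<close> and \<open>C\<close>. Both
  \<open>s\<close> and the top of \<open>x\<close> are ancestors of the lowest bag of
  \<open>C\<close>, hence comparable, and convexity settles either order.\<close>

lemma below_in_bag:
  assumes "C \<in> touching x \<phi>" "x \<in> cnf_vars \<phi>" "Inr C \<notin> B (top (Inl x))"
    and "y \<in> atom ` C" "before y x"
  shows "Inl y \<in> B (top (Inl x))"
proof -
  let ?t = "top (Inl x)"
  have C: "C \<in> \<phi>" using assms(1) by (simp add: touching_def)
  obtain w where w: "w \<in> atom ` C" "w = x \<or> before x w"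
    using assms(1) by (auto simp: touching_def above_def)
  then have xw: "?t \<unlhd> top (Inl w)" by (auto simp: before_def)
  obtain b where b: "\<And>s. s \<in> bag_nodes T B (Inr C) \<Longrightarrow> s \<unlhd> b"
    using directed_path_bottom sided C unfolding one_sided_def by metis
  obtain s where s: "s \<in> bag_nodes T B (Inl y)" "s \<in> bag_nodes T B (Inr C)"
    using common_bag[OF C assms(4)] by blast
  obtain s' where s': "s' \<in> bag_nodes T B (Inl w)" "s' \<in> bag_nodes T B (Inr C)"
    using common_bag[OF C w(1)] by blast
  have "?t \<unlhd> s'"
    using xw top_anc[OF var_in_graph s'(1)] atom_in_vars[OF C w(1)] by (meson rtrancl_trans)
  then have "?t \<unlhd> b" using b[OF s'(2)] by (rule rtrancl_trans)
  then consider "s \<unlhd> ?t" | "?t \<unlhd> s" using anc_linear b[OF s(2)] by blast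
  then show ?thesis
  proof cases
    \<comment> \<open>Now \<open>?t\<close> lies between two bags of \<open>C\<close>, namely
      \<open>s\<close> and \<open>s'\<close>, so \<open>C\<close> would be in its bag, contrary to
      assumption.\<close>
    case 1
    have "top (Inr C) \<unlhd> ?t"
      using top_anc[OF clause_in_graph[OF C] s(2)] 1 by (rule rtrancl_trans)
    from bag_convex[OF clause_in_graph[OF C] s'(2) this \<open>?t \<unlhd> s'\<close>] assms(3)
    show ?thesis by (simp add: bag_nodes_def)
  next
    \<comment> \<open>Now \<open>?t\<close> lies between the top of \<open>y\<close> and the bag
      \<open>s\<close> containing \<open>y\<close>.\<close>
    case 2
    have "top (Inl y) \<unlhd> ?t" using assms(5) by (simp add: before_def)
    from bag_convex[OF var_in_graph s(1) this 2] atom_in_vars[OF C assms(4)]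
    show ?thesis by (simp add: bag_nodes_def)
  qed
qed

text \<open>A residual set is determined by a subset of the topmost bag of \<open>x\<close>: the
  true variables in it together with the satisfied clauses in it.\<close>

lemma card_residual:
  assumes x: "x \<in> cnf_vars \<phi>"
  shows "finite (range (residual x))" "card (range (residual x)) \<le> 2 ^ (td_width T B + 1)"
proof -
  let ?t = "top (Inl x)"
  define dead where "dead \<rho> C \<longleftrightarrow> (\<exists>l\<in>C. before (atom l) x \<and> lit_true \<rho> l)" for \<rho> C
  define code where "code \<rho> = {v \<in> B ?t. case v of Inl y \<Rightarrow> \<rho> y | Inr C \<Rightarrow> dead \<rho> C}" for \<rho>
  have t: "?t \<in> pverts T" using top(1)[OF var_in_graph[OF x]] by (simp add: bag_nodes_def)
  have dead_code: "dead \<rho> C \<longleftrightarrow> dead \<rho>' C" if "code \<rho> = code \<rho>'" "C \<in> touching x \<phi>" for \<rho> \<rho>' C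
  proof (cases "Inr C \<in> B ?t")
    case True
    then have "dead \<rho> C \<longleftrightarrow> Inr C \<in> code \<rho>" for \<rho> by (simp add: code_def)
    with that(1) show ?thesis by simp
  next
    \<comment> \<open>A clause outside the bag has all its queried variables inside, so their
      recorded values decide whether it is satisfied.\<close>
    case False
    have "\<rho> (atom l) \<longleftrightarrow> \<rho>' (atom l)" if "l \<in> C" "before (atom l) x" for l
    proof -
      have "Inl (atom l) \<in> B ?t"
        using below_in_bag[OF \<open>C \<in> touching x \<phi>\<close> x False] that by blast
      then have code: "\<sigma> (atom l) \<longleftrightarrow> Inl (atom l) \<in> code \<sigma>" for \<sigma> by (simp add: code_def)
      show ?thesis using \<open>code \<rho> = code \<rho>'\<close> code[of \<rho>] code[of \<rho>'] by simp
    qed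
    then show ?thesis unfolding dead_def using lit_true_cong[of \<rho> _ \<rho>'] by blast
  qed
  have residual_dead: "residual x \<rho> = {C \<in> touching x \<phi>. \<not> dead \<rho> C}" for \<rho>
    by (auto simp: residual_def dead_def)
  have "residual x \<rho> = residual x \<rho>'" if "code \<rho> = code \<rho>'" for \<rho> \<rho>'
    using dead_code[OF that] by (auto simp: residual_dead)
  \<comment> \<open>\<open>residual x\<close> factors through \<open>code\<close>: any assignment
    with the same code may replace \<open>\<rho>\<close>.\<close>
  then have factor: "residual x \<rho> = residual x (SOME \<rho>'. code \<rho>' = code \<rho>)" for \<rho>
    by (metis (mono_tags, lifting) someI_ex)
  let ?h = "\<lambda>c. residual x (SOME \<rho>'. code \<rho>' = c)"
  have sub: "range (residual x) \<subseteq> ?h ` Pow (B ?t)"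
  proof
    fix U assume "U \<in> range (residual x)"
    then obtain \<rho> where "U = ?h (code \<rho>)" using factor by blast
    moreover have "code \<rho> \<in> Pow (B ?t)" by (auto simp: code_def)
    ultimately show "U \<in> ?h ` Pow (B ?t)" by blast
  qed
  have fin_Pow: "finite (Pow (B ?t))" using finite_bag[OF t] by simp
  show "finite (range (residual x))" using finite_subset[OF sub finite_imageI[OF fin_Pow]] .
  have "card (range (residual x)) \<le> card (Pow (B ?t))"
    using surj_card_le[OF fin_Pow sub] .
  also have "\<dots> = 2 ^ card (B ?t)" by (rule card_Pow[OF finite_bag[OF t]])
  also have "\<dots> \<le> 2 ^ (td_width T B + 1)"
  proof (rule power_increasing)
    \<comment> \<open>The truncated subtraction in \<open>td_width\<close> does no harm, since
      adding 1 gives at least the maximum.\<close>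
    have "card (B ?t) \<le> Max ((\<lambda>t. card (B t)) ` pverts T)"
      using t pair_fin_digraph.pair_finite_verts[OF fin] by (intro Max_ge) auto
    then show "card (B ?t) \<le> td_width T B + 1" by (simp add: td_width_def)
  qed simp
  finally show "card (range (residual x)) \<le> 2 ^ (td_width T B + 1)" .
qed

lemma small_refutation:
  assumes "\<not> satisfiable \<phi>"
  shows "\<exists>(R :: nat pair_pre_digraph) var lab cl. regular_resolution_refutation \<phi> R var lab cl \<and>
    card (pverts R) \<le> 1 + 2 * card (cnf_vars \<phi>) * 2 ^ (td_width T B + 1)"
  using refutation[OF assms card_residual] .

end

theorem theorem2:
  shows "\<exists>c::real. \<forall>(\<phi> :: 'v clauses) (T :: 't pair_pre_digraph) r B (n::nat) (k::nat).
    cnf \<phi> \<and> \<not> satisfiable \<phi> \<and> card (cnf_vars \<phi>) = n \<and>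
    rooted_binary_tree T r \<and>
    tree_decomposition (incidence_graph \<phi>) T r B \<and> one_sided \<phi> T B \<and> td_width T B = k
    \<longrightarrow> (\<exists>(R :: nat pair_pre_digraph) var lab cl.
          regular_resolution_refutation \<phi> R var lab cl \<and>
          real (card (pverts R)) \<le> c * 4 ^ k * real (max 1 n))"
\<comment> \<open>The size is at most \<open>1 + 2 * n * 2 ^ (k + 1)\<close>, that is
  \<open>1 + 4 * n * 2 ^ k\<close>. The source node is absorbed by a fifth copy of
  \<open>max 1 n * 2 ^ k\<close>, which is at least 1 even for \<open>n = 0\<close>.\<close>
proof (intro exI[of _ 5] allI impI, elim conjE)
  fix \<phi> :: "'v clauses" and T :: "'t pair_pre_digraph" and r B and n k :: nat
  assume "cnf \<phi>" "\<not> satisfiable \<phi>" "card (cnf_vars \<phi>) = n" "rooted_binary_tree T r"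
    "tree_decomposition (incidence_graph \<phi>) T r B" "one_sided \<phi> T B" "td_width T B = k"
  then interpret one_sided_decomposition T r \<phi> B
    by unfold_locales (auto simp: rooted_binary_tree_def)
  obtain R :: "nat pair_pre_digraph" and var lab cl
    where R: "regular_resolution_refutation \<phi> R var lab cl"
      and size: "card (pverts R) \<le> 1 + 2 * card (cnf_vars \<phi>) * 2 ^ (td_width T B + 1)"
    using small_refutation[OF \<open>\<not> satisfiable \<phi>\<close>] by blast
  have "card (pverts R) \<le> 1 + 4 * (n * 2 ^ k)"
    using size \<open>card (cnf_vars \<phi>) = n\<close> \<open>td_width T B = k\<close> by simp
  also have "\<dots> \<le> 5 * (max 1 n * 2 ^ k)"
  proof -
    have "1 * 1 \<le> max 1 n * (2::nat) ^ k" by (intro mult_le_mono) auto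
    moreover have "n * 2 ^ k \<le> max 1 n * (2::nat) ^ k" by (intro mult_le_mono) auto
    ultimately show ?thesis by linarith
  qed
  also have "\<dots> \<le> 5 * (max 1 n * 4 ^ k)"
    by (intro mult_le_mono power_mono) auto
  finally have "real (card (pverts R)) \<le> real (5 * (max 1 n * 4 ^ k))"
    by (rule of_nat_mono)
  then have "real (card (pverts R)) \<le> 5 * 4 ^ k * real (max 1 n)"
    by (simp add: mult_ac)
  with R show "\<exists>(R :: nat pair_pre_digraph) var lab cl.
      regular_resolution_refutation \<phi> R var lab cl \<and>
      real (card (pverts R)) \<le> 5 * 4 ^ k * real (max 1 n)"
    by blast
qed

end
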